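(* Consider the second-order oscillatory problem $q''(t)+Mq(t)=f(q(t))$, $q(0)=q_0$, $q'(0)=q_0'$, with $M\in\mathbb R^{d\times d}$, written as the first-order system $$\begin{pmatrix} q \\ p \end{pmatrix}'+\begin{pmatrix} 0 & -I \\ M & 0 \end{pmatrix}\begin{pmatrix} q \\ p \end{pmatrix}=\begin{pmatrix} 0 \\ f(q) \end{pmatrix},\qquad\begin{pmatrix} q(0) \\ p(0) \end{pmatrix}=\begin{pmatrix} q_0 \\ q_0' \end{pmatrix}.$$ Then the method EFCM($k,n$) applied to this first-order system reduces to the trigonometric Fourier collocation method (TFCM) for the second-order problem with the same $k$, $n$, nodes $c_l$ and weights $b_l$.
   Context: Shifted Legendre polynomials: $\widehat P_j(x)=(-1)^j\sqrt{2j+1}\sum_{i=0}^{j}\binom{j}{i}\binom{j+i}{i}(-x)^i$, so that $\int_0^1\widehat P_i\widehat P_j\,dx=\delta_{ij}$. $\varphi$-functions: $\varphi_0(z)=e^z$, $\varphi_i(z)=\int_0^1e^{(1-\sigma)z}\frac{\sigma^{i-1}}{(i-1)!}d\sigma$ for $i\ge1$. Let $0\le c_1\le\dots\le c_k\le1$ and $b_1,\dots,b_k$ be the nodes and weights of a quadrature formula on $[0,1]$ that is exact for polynomials of degree up to $m-1$, with $m\ge k$. Let $2\le n\le k$ and let $h>0$ be the stepsize. For a first-order problem $u'+Au=g(t,u)$, $u(0)=u_0$, with $A$ a square matrix and $V:=hA$, EFCM($k,n$) (the $k$-stage exponential Fourier collocation method with integer $n$) is $$v_i=\varphi_0(-c_iV)u_0+c_ih\sum_{l=1}^kb_l\Big(\sum_{j=0}^{n-1}I_{j,c_i}(V)\widehat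 P_j(c_l)\Big)g(c_lh,v_l),\quad i=1,\dots,k,$$ $$v(h)=\varphi_0(-V)u_0+h\sum_{l=1}^kb_l\Big(\sum_{j=0}^{n-1}I_j(V)\widehat P_j(c_l)\Big)g(c_lh,v_l),$$ where $I_j(V)=\int_0^1\widehat P_j(z)e^{-(1-z)V}dz=\sqrt{2j+1}\sum_{i=0}^j(-1)^{j+i}\frac{(j+i)!}{i!(j-i)!}\varphi_{i+1}(-V)$ and $I_{j,c}(V)=\int_0^1\widehat P_j(cz)e^{-(1-z)cV}dz=(-1)^j\sqrt{2j+1}\sum_{i=0}^j(-c)^i\frac{(j+i)!}{i!(j-i)!}\varphi_{i+1}(-cV)$. The TFCM for $q''+Mq=f(q)$, $q(0)=q_0$, $q'(0)=q_0'$ (with parameters $k,n$, nodes $c_l$, weights $b_l$, stepsize $h$) is the method whose numerical solution is $(v_T(h),u_T(h))$, with stage values $v_T(c_lh)$, where $(v_T,u_T)$ is the solution on $[0,h]$ of $$\begin{pmatrix} v_T(\xi h) \\ u_T(\xi h) \end{pmatrix}'=\begin{pmatrix} u_T(\xi h) \\ -Mv_T(\xi h)+\sum_{j=0}^{n-1}\widehat P_j(\xi)\sum_{l=1}^kb_l\widehat P_j(c_l)f(v_T(c_lh)) \end{pmatrix},\qquad\begin{pmatrix} v_T(0) \\ u_T(0) \end{pmatrix}=\begin{pmatrix} q_0 \\ q_0' \end{pmatrix},$$ where $\xi\in[0,1]$ and the prime denotes the derivative with respect to time evaluated at time $\xi h$. *)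

theory Defs
  imports "HOL-Analysis.Analysis" "HOL-Computational_Algebra.Polynomial"
begin

definition legendre_shifted :: "nat \<Rightarrow> real \<Rightarrow> real" where
  "legendre_shifted j x =
     (-1) ^ j * sqrt (real (2 * j + 1)) *
     (\<Sum>i\<le>j. real (j choose i) * real ((j + i) choose i) * (- x) ^ i)"

text \<open>Stages are numbered \<open>1, \<dots>, k\<close>; values of \<open>b\<close> and \<open>c\<close> at other indices are irrelevant.\<close>

definition quadrature_exact :: "nat \<Rightarrow> (nat \<Rightarrow> real) \<Rightarrow> (nat \<Rightarrow> real) \<Rightarrow> nat \<Rightarrow> bool" where
  "quadrature_exact k b c r \<longleftrightarrow>
     (\<forall>p :: real poly. degree p \<le> r \<longrightarrow>
        (\<Sum>l=1..k. b l * poly p (c l)) = integral {0..1} (poly p))"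

text \<open>The library has no normed-algebra structure for the matrix product on \<open>real^'n^'n\<close>
  (\<open>*\<close> and \<open>^\<close> on this type are componentwise), so the exponential series is written out.\<close>

primrec mat_pow :: "real^'n^'n \<Rightarrow> nat \<Rightarrow> real^'n^'n" where
  "mat_pow Z 0 = mat 1"
| "mat_pow Z (Suc r) = Z ** mat_pow Z r"

definition mat_exp :: "real^'n^'n \<Rightarrow> real^'n^'n" where
  "mat_exp Z = (\<Sum>r. (1 / fact r) *\<^sub>R mat_pow Z r)"

fun phi :: "nat \<Rightarrow> real^'n^'n \<Rightarrow> real^'n^'n" where
  "phi 0 Z = mat_exp Z"
| "phi (Suc i) Z =
     integral {0..1} (\<lambda>\<sigma>. (\<sigma> ^ i / fact i) *\<^sub>R mat_exp ((1 - \<sigma>) *\<^sub>R Z))"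

definition I_coeff :: "nat \<Rightarrow> real^'n^'n \<Rightarrow> real^'n^'n" where
  "I_coeff j V =
     integral {0..1} (\<lambda>z. legendre_shifted j z *\<^sub>R mat_exp (- ((1 - z) *\<^sub>R V)))"

definition I_coeff_at :: "nat \<Rightarrow> real \<Rightarrow> real^'n^'n \<Rightarrow> real^'n^'n" where
  "I_coeff_at j \<gamma> V =
     integral {0..1} (\<lambda>z. legendre_shifted j (\<gamma> * z) *\<^sub>R mat_exp (- (((1 - z) * \<gamma>) *\<^sub>R V)))"

text \<open>The method is implicit, so one step is a relation: \<open>v\<close> is a family of stage values
  solving the stage equations, and \<open>w\<close> is the resulting approximation at time \<open>h\<close>.\<close>

definition efcm ::
  "nat \<Rightarrow> nat \<Rightarrow> (nat \<Rightarrow> real) \<Rightarrow> (nat \<Rightarrow> real) \<Rightarrow> real \<Rightarrow>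
   real^'n^'n \<Rightarrow> (real \<Rightarrow> real^'n \<Rightarrow> real^'n) \<Rightarrow> real^'n \<Rightarrow>
   (nat \<Rightarrow> real^'n) \<Rightarrow> real^'n \<Rightarrow> bool" where
  "efcm k n c b h A g u0 v w \<longleftrightarrow>
     (let V = h *\<^sub>R A in
       (\<forall>i\<in>{1..k}. v i = phi 0 (- (c i *\<^sub>R V)) *v u0 +
          (c i * h) *\<^sub>R (\<Sum>l=1..k. b l *\<^sub>R
            ((\<Sum>j<n. legendre_shifted j (c l) *\<^sub>R I_coeff_at j (c i) V) *v g (c l * h) (v l)))) \<and>
       w = phi 0 (- V) *v u0 +
          h *\<^sub>R (\<Sum>l=1..k. b l *\<^sub>R
            ((\<Sum>j<n. legendre_shifted j (c l) *\<^sub>R I_coeff j V) *v g (c l * h) (v l))))"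

definition tfcm_solution ::
  "nat \<Rightarrow> nat \<Rightarrow> (nat \<Rightarrow> real) \<Rightarrow> (nat \<Rightarrow> real) \<Rightarrow> real \<Rightarrow>
   real^'d^'d \<Rightarrow> (real^'d \<Rightarrow> real^'d) \<Rightarrow> real^'d \<Rightarrow> real^'d \<Rightarrow>
   (real \<Rightarrow> real^'d) \<Rightarrow> (real \<Rightarrow> real^'d) \<Rightarrow> bool" where
  "tfcm_solution k n c b h M f q0 q0' vT uT \<longleftrightarrow>
     vT 0 = q0 \<and> uT 0 = q0' \<and>
     (\<forall>\<xi>\<in>{0..1}.
        (vT has_vector_derivative uT (\<xi> * h)) (at (\<xi> * h) within {0..h}) \<and>
        (uT has_vector_derivative
           (- (M *v vT (\<xi> * h)) +
            (\<Sum>j<n. legendre_shifted j \<xi> *\<^sub>R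
               (\<Sum>l=1..k. (b l * legendre_shifted j (c l)) *\<^sub>R f (vT (c l * h))))))
          (at (\<xi> * h) within {0..h}))"

text \<open>As for \<open>efcm\<close>: \<open>Q\<close> are the stage values, and \<open>(q1, p1)\<close> is the numerical solution
  at time \<open>h\<close>.\<close>

definition tfcm ::
  "nat \<Rightarrow> nat \<Rightarrow> (nat \<Rightarrow> real) \<Rightarrow> (nat \<Rightarrow> real) \<Rightarrow> real \<Rightarrow>
   real^'d^'d \<Rightarrow> (real^'d \<Rightarrow> real^'d) \<Rightarrow> real^'d \<Rightarrow> real^'d \<Rightarrow>
   (nat \<Rightarrow> real^'d) \<Rightarrow> real^'d \<Rightarrow> real^'d \<Rightarrow> bool" where
  "tfcm k n c b h M f q0 q0' Q q1 p1 \<longleftrightarrow>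
     (\<exists>vT uT. tfcm_solution k n c b h M f q0 q0' vT uT \<and>
        (\<forall>l\<in>{1..k}. Q l = vT (c l * h)) \<and> q1 = vT h \<and> p1 = uT h)"

definition stack :: "real^'d \<Rightarrow> real^'d \<Rightarrow> real^('d + 'd)" where
  "stack x y = (\<chi> i. case i of Inl a \<Rightarrow> x $ a | Inr a \<Rightarrow> y $ a)"

definition upper :: "real^('d + 'd) \<Rightarrow> real^'d" where
  "upper u = (\<chi> a. u $ Inl a)"

definition block_matrix ::
  "real^'d^'d \<Rightarrow> real^'d^'d \<Rightarrow> real^'d^'d \<Rightarrow> real^'d^'d \<Rightarrow> real^('d + 'd)^('d + 'd)" where
  "block_matrix P Q R S =
     (\<chi> i j. case i of
        Inl a \<Rightarrow> (case j of Inl a' \<Rightarrow> P $ a $ a' | Inr a' \<Rightarrow> Q $ a $ a')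
      | Inr a \<Rightarrow> (case j of Inl a' \<Rightarrow> R $ a $ a' | Inr a' \<Rightarrow> S $ a $ a'))"

definition system_matrix :: "real^'d^'d \<Rightarrow> real^('d + 'd)^('d + 'd)" where
  "system_matrix M = block_matrix 0 (- mat 1) M 0"

definition system_rhs :: "(real^'d \<Rightarrow> real^'d) \<Rightarrow> real \<Rightarrow> real^('d + 'd) \<Rightarrow> real^('d + 'd)" where
  "system_rhs f t u = stack 0 (f (upper u))"

end

theory Submission
  imports Defs
begin

text \<open>
  Once the stage values of \<open>g\<close> are fixed, an EFCM step is no approximation any more: it solves
  exactly the linear equation \<open>y' + A y = G\<close>, where \<open>G\<close> is the discrete Legendre expansion, cut
  off after \<open>n\<close> terms, of the right-hand side. Indeed, variation of constants,
  rescaled to \<open>[0, 1]\<close>, reads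
  \<open>y (\<gamma> h) = exp (- \<gamma> h A) u0 + \<gamma> h \<integral> exp (- (1 - z) \<gamma> h A) G (z \<gamma> h) dz\<close>,
  and integrating the Legendre polynomials in \<open>G\<close> one by one turns the integral into the
  coefficients \<open>I_coeff_at\<close>. This is \<open>efcm_value_eq_solution\<close>.
  Since the linear equation has a solution for every family of stage values
  (\<open>linear_ode_solution_exists\<close>), EFCM is equivalent to the existence of a function that solves
  the truncated equation and takes the stage values at the nodes (\<open>efcm_iff_fourier_ode\<close>).

  TFCM is defined by the same kind of function, for the pair of position and velocity. With the
  block matrix of the first-order system, the upper half of the truncated equation says
  \<open>v' = u\<close>, because the upper half of the right-hand side vanishes, and the lower half is the
  equation for \<open>u'\<close> (\<open>tfcm_solution_iff_system\<close>). The nonlinearity sees only the positions, so the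
  velocity components \<open>P\<close> of the EFCM stages can be read off from, or prescribed by, the
  velocity \<open>u\<close> of the TFCM solution.
\<close>

section \<open>The matrix exponential\<close>

lemma bounded_bilinear_matrix_vector:
  "bounded_bilinear ((*v) :: real^'n^'m \<Rightarrow> real^'n \<Rightarrow> real^'m)"
proof -
  have "bilinear ((*v) :: real^'n^'m \<Rightarrow> real^'n \<Rightarrow> real^'m)"
    by (auto simp: bilinear_def linear_iff matrix_vector_mult_add_rdistrib
        matrix_vector_mult_def vec_eq_iff sum.distrib algebra_simps sum_distrib_left)
  then show ?thesis
    by (simp add: bilinear_conv_bounded_bilinear)
qed

lemma bounded_bilinear_matrix_matrix:
  "bounded_bilinear ((**) :: real^'n^'m \<Rightarrow> real^'p^'n \<Rightarrow> real^'p^'m)"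
proof -
  have "bilinear ((**) :: real^'n^'m \<Rightarrow> real^'p^'n \<Rightarrow> real^'p^'m)"
    by (auto simp: bilinear_def linear_iff
        matrix_matrix_mult_def vec_eq_iff sum.distrib algebra_simps sum_distrib_left)
  then show ?thesis
    by (simp add: bilinear_conv_bounded_bilinear)
qed

interpretation matvec: bounded_bilinear "(*v) :: real^'n^'m \<Rightarrow> real^'n \<Rightarrow> real^'m"
  by (rule bounded_bilinear_matrix_vector)

interpretation matmat: bounded_bilinear "(**) :: real^'n^'m \<Rightarrow> real^'p^'n \<Rightarrow> real^'p^'m"
  by (rule bounded_bilinear_matrix_matrix)

lemma mat_pow_scaleR: "mat_pow (t *\<^sub>R Z) r = t ^ r *\<^sub>R mat_pow Z r"
  by (induction r) (simp_all add: matmat.scaleR_left matmat.scaleR_right)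

lemma mat_pow_commute: "mat_pow Z r ** Z = Z ** mat_pow Z r"
  by (induction r) (simp_all add: matrix_mul_assoc[symmetric])

text \<open>The matrix product is submultiplicative up to a constant \<open>K\<close>, so the series is dominated
  by the scalar exponential series of \<open>norm Z * K\<close>.\<close>

lemma summable_mat_exp: "summable (\<lambda>r. (1 / fact r) *\<^sub>R mat_pow (Z :: real^'n^'n) r)"
proof -
  obtain K where K: "K > 0"
    "\<And>A B. norm ((A :: real^'n^'n) ** (B :: real^'n^'n)) \<le> norm A * norm B * K"
    using matmat.pos_bounded by blast
  define x where "x = norm Z * K"
  have pow: "norm (mat_pow Z r) \<le> norm (mat 1 :: real^'n^'n) * x ^ r" for r
  proof (induction r)
    case (Suc r)
    have "norm (mat_pow Z (Suc r)) \<le> norm Z * norm (mat_pow Z r) * K"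
      unfolding mat_pow.simps by (rule K(2))
    also have "\<dots> = x * norm (mat_pow Z r)"
      by (simp add: x_def)
    also have "\<dots> \<le> x * (norm (mat 1 :: real^'n^'n) * x ^ r)"
      by (rule mult_left_mono[OF Suc]) (use K(1) in \<open>simp add: x_def\<close>)
    finally show ?case
      by (simp add: mult_ac)
  qed simp
  show ?thesis
  proof (rule summable_comparison_test')
    show "summable (\<lambda>r. norm (mat 1 :: real^'n^'n) * (inverse (fact r) * x ^ r))"
      by (intro summable_mult summable_exp)
    show "norm ((1 / fact r) *\<^sub>R mat_pow Z r)
        \<le> norm (mat 1 :: real^'n^'n) * (inverse (fact r) * x ^ r)" for r
    proof -
      have "inverse (fact r) * norm (mat_pow Z r)
          \<le> inverse (fact r) * (norm (mat 1 :: real^'n^'n) * x ^ r)"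
        by (rule mult_left_mono[OF pow]) simp
      then show ?thesis
        by (simp add: inverse_eq_divide)
    qed
  qed
qed

lemma mat_exp_sums: "(\<lambda>r. (1 / fact r) *\<^sub>R mat_pow Z r) sums mat_exp Z"
  unfolding mat_exp_def by (rule summable_sums[OF summable_mat_exp])

lemma mat_exp_0 [simp]: "mat_exp 0 = mat 1"
proof -
  have "(\<lambda>r. (1 / fact r) *\<^sub>R mat_pow (0 :: real^'n^'n) r) sums mat 1"
  proof -
    have "(\<lambda>r. (1 / fact r) *\<^sub>R mat_pow (0 :: real^'n^'n) r)
        = (\<lambda>r. if r = 0 then mat 1 else 0)"
      by (rule ext, rename_tac r, case_tac r) (simp_all add: matmat.zero_left)
    then show ?thesis
      by (simp add: sums_single[of 0 "\<lambda>_. mat 1 :: real^'n^'n"])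
  qed
  then show ?thesis
    using mat_exp_sums sums_unique2 by blast
qed

lemma mat_exp_commute: "mat_exp (t *\<^sub>R Z) ** Z = Z ** mat_exp (t *\<^sub>R Z)"
proof -
  have "(\<lambda>r. ((1 / fact r) *\<^sub>R mat_pow (t *\<^sub>R Z) r) ** Z) sums (mat_exp (t *\<^sub>R Z) ** Z)"
    by (rule bounded_linear.sums[OF matmat.bounded_linear_left mat_exp_sums])
  moreover have "(\<lambda>r. Z ** ((1 / fact r) *\<^sub>R mat_pow (t *\<^sub>R Z) r)) sums (Z ** mat_exp (t *\<^sub>R Z))"
    by (rule bounded_linear.sums[OF matmat.bounded_linear_right mat_exp_sums])
  moreover have "((1 / fact r) *\<^sub>R mat_pow (t *\<^sub>R Z) r) ** Z
      = Z ** ((1 / fact r) *\<^sub>R mat_pow (t *\<^sub>R Z) r)" for r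
    by (simp add: mat_pow_scaleR matmat.scaleR_left matmat.scaleR_right mat_pow_commute)
  ultimately show ?thesis
    by (simp add: sums_unique2)
qed

text \<open>Every coordinate of \<open>t \<mapsto> mat_exp (t Z)\<close> is an everywhere convergent real power
  series, so the series may be differentiated term by term.\<close>

lemma mat_exp_has_vector_derivative:
  fixes Z :: "real^'n^'n"
  shows "((\<lambda>t. mat_exp (t *\<^sub>R Z)) has_vector_derivative Z ** mat_exp (t *\<^sub>R Z)) (at t within S)"
proof -
  have "((\<lambda>t. mat_exp (t *\<^sub>R Z) \<bullet> e) has_field_derivative (Z ** mat_exp (t *\<^sub>R Z)) \<bullet> e) (at t)"
    for e
  proof -
    define a where "a r = (1 / fact r) * (mat_pow Z r \<bullet> e)" for r
    have sums: "(\<lambda>r. a r * s ^ r) sums (mat_exp (s *\<^sub>R Z) \<bullet> e)" for s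
      using bounded_linear.sums[OF bounded_linear_inner_left[of e] mat_exp_sums[of "s *\<^sub>R Z"]]
      by (simp add: a_def mat_pow_scaleR mult_ac)
    have "diffs a r * t ^ r = (Z ** ((1 / fact r) *\<^sub>R mat_pow (t *\<^sub>R Z) r)) \<bullet> e" for r
      by (simp add: diffs_def a_def mat_pow_scaleR matmat.scaleR_right del: of_nat_Suc)
    moreover have "(\<lambda>r. (Z ** ((1 / fact r) *\<^sub>R mat_pow (t *\<^sub>R Z) r)) \<bullet> e)
        sums ((Z ** mat_exp (t *\<^sub>R Z)) \<bullet> e)"
      by (intro bounded_linear.sums[OF bounded_linear_inner_left]
          bounded_linear.sums[OF matmat.bounded_linear_right] mat_exp_sums)
    ultimately have "(\<lambda>r. diffs a r * t ^ r) sums ((Z ** mat_exp (t *\<^sub>R Z)) \<bullet> e)"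
      by simp
    moreover have "((\<lambda>s. \<Sum>r. a r * s ^ r) has_field_derivative (\<Sum>r. diffs a r * t ^ r)) (at t)"
      by (rule termdiffs_strong_converges_everywhere) (use sums sums_summable in blast)
    ultimately show ?thesis
      using sums by (simp add: sums_iff)
  qed
  then have "((\<lambda>t. mat_exp (t *\<^sub>R Z)) has_vector_derivative Z ** mat_exp (t *\<^sub>R Z)) (at t)"
    unfolding has_vector_derivative_def
    by (subst has_derivative_componentwise_within)
      (simp add: has_field_derivative_def mult_commute_abs)
  then show ?thesis
    by (rule has_vector_derivative_at_within)
qed

lemma continuous_on_mat_exp [continuous_intros]:
  fixes Z :: "real^'n^'n"
  assumes "continuous_on S f"
  shows "continuous_on S (\<lambda>x. mat_exp (f x *\<^sub>R Z))"
proof -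
  have "continuous_on UNIV (\<lambda>t. mat_exp (t *\<^sub>R Z))"
    using mat_exp_has_vector_derivative has_vector_derivative_continuous
    by (fastforce simp: continuous_on_eq_continuous_within)
  from continuous_on_compose2[OF this assms] show ?thesis
    by simp
qed

text \<open>The derivative of \<open>exp (t Z) exp (- t Z)\<close> is \<open>exp (t Z) (Z - Z) exp (- t Z)\<close>,
  because \<open>Z\<close> commutes with \<open>exp (t Z)\<close>.\<close>

lemma mat_exp_inverse: "mat_exp (t *\<^sub>R Z) ** mat_exp (t *\<^sub>R (- Z)) = mat 1"
proof -
  define F where "F s = mat_exp (s *\<^sub>R Z) ** mat_exp (s *\<^sub>R (- Z))" for s
  have "(F has_vector_derivative 0) (at s)" for s
  proof -
    have "(F has_vector_derivative mat_exp (s *\<^sub>R Z) ** (- Z ** mat_exp (s *\<^sub>R (- Z)))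
        + Z ** mat_exp (s *\<^sub>R Z) ** mat_exp (s *\<^sub>R (- Z))) (at s)"
      unfolding F_def
      by (rule matmat.has_vector_derivative[OF mat_exp_has_vector_derivative
            mat_exp_has_vector_derivative])
    then show ?thesis
      by (simp add: mat_exp_commute[symmetric] matmat.minus_left matmat.minus_right
          flip: matrix_mul_assoc)
  qed
  then obtain C where "\<And>s. F s = C"
    using has_vector_derivative_zero_constant[of UNIV F] by auto
  then have "F t = F 0"
    by simp
  then show ?thesis
    by (simp add: F_def)
qed

section \<open>Linear differential equations\<close>

text \<open>The value of the integral is \<open>y \<tau>\<close> minus the value at \<open>z = 0\<close> of
  \<open>z \<mapsto> exp (- (1 - z) \<tau> A) y (z \<tau>)\<close>, and the integrand is the derivative of that function.
  Integrating over \<open>[0, 1]\<close> instead of \<open>[0, \<tau>]\<close> gives the form of the integrals in the method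
  without a substitution, so \<open>\<tau> = 0\<close>, which arises from a node at 0, is not a special case.\<close>

lemma variation_of_constants:
  fixes A :: "real^'n^'n"
  assumes ode: "\<And>s. s \<in> {0..h} \<Longrightarrow>
      (y has_vector_derivative (G s - A *v y s)) (at s within {0..h})"
    and \<tau>: "\<tau> \<in> {0..h}"
  shows "((\<lambda>z. \<tau> *\<^sub>R (mat_exp (- (((1 - z) * \<tau>) *\<^sub>R A)) *v G (z * \<tau>)))
    has_integral (y \<tau> - mat_exp (- (\<tau> *\<^sub>R A)) *v y 0)) {0..1}"
proof -
  define E where "E z = mat_exp (((z - 1) * \<tau>) *\<^sub>R A)" for z
  have E: "mat_exp (- (((1 - z) * \<tau>) *\<^sub>R A)) = E z" for z
    by (simp add: E_def algebra_simps flip: scaleR_minus_left)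
  have "((\<lambda>z. E z *v y (z * \<tau>)) has_vector_derivative \<tau> *\<^sub>R (E z *v G (z * \<tau>)))
      (at z within {0..1})" if z: "z \<in> {0..1}" for z
  proof -
    have "z * \<tau> \<le> 1 * h"
      using z \<tau> by (intro mult_mono) auto
    then have z\<tau>: "z * \<tau> \<in> {0..h}"
      using z \<tau> by simp
    have dE: "(E has_vector_derivative \<tau> *\<^sub>R (A ** E z)) (at z within {0..1})"
      unfolding E_def
      by (rule vector_diff_chain_within[of "\<lambda>z. (z - 1) * \<tau>" \<tau> z "{0..1}"
            "\<lambda>t. mat_exp (t *\<^sub>R A)", unfolded o_def])
        (auto intro!: derivative_eq_intros mat_exp_has_vector_derivative)
    have "((\<lambda>z. z * \<tau>) has_vector_derivative \<tau>) (at z within {0..1})"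
      by (auto intro!: derivative_eq_intros)
    moreover have "(y has_vector_derivative (G (z * \<tau>) - A *v y (z * \<tau>)))
        (at (z * \<tau>) within (\<lambda>z. z * \<tau>) ` {0..1})"
    proof (rule has_vector_derivative_within_subset[OF ode[OF z\<tau>]])
      have "x * \<tau> \<in> {0..h}" if "x \<in> {0..1}" for x
        using mult_mono[of x 1 \<tau> h] that \<tau> by simp
      then show "(\<lambda>z. z * \<tau>) ` {0..1} \<subseteq> {0..h}"
        by blast
    qed
    ultimately have dy: "((\<lambda>z. y (z * \<tau>)) has_vector_derivative
        \<tau> *\<^sub>R (G (z * \<tau>) - A *v y (z * \<tau>))) (at z within {0..1})"
      using vector_diff_chain_within unfolding o_def by fast
    \<comment> \<open>The two occurrences of \<open>A\<close> cancel, since \<open>A\<close> commutes with its exponential.\<close>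
    have "E z *v (\<tau> *\<^sub>R (G (z * \<tau>) - A *v y (z * \<tau>))) + (\<tau> *\<^sub>R (A ** E z)) *v y (z * \<tau>)
        = \<tau> *\<^sub>R (E z *v G (z * \<tau>))"
      by (simp add: E_def mat_exp_commute[symmetric] matvec.scaleR_left matvec.scaleR_right
          matvec.diff_right scaleR_diff_right matrix_vector_mul_assoc)
    with matvec.has_vector_derivative[OF dE dy] show ?thesis
      by simp
  qed
  then have "((\<lambda>z. \<tau> *\<^sub>R (E z *v G (z * \<tau>))) has_integral
      (E 1 *v y (1 * \<tau>) - E 0 *v y (0 * \<tau>))) {0..1}"
    by (intro fundamental_theorem_of_calculus) auto
  then show ?thesis
    unfolding E by (simp add: E_def)
qed

text \<open>The explicit solution is \<open>exp (- s A) X s\<close> with \<open>X' = exp (s A) G\<close>: the factor in front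
  accounts for \<open>- A y\<close>, and the two exponentials cancel in the remaining term.\<close>

lemma linear_ode_solution_exists:
  fixes A :: "real^'n^'n" and u0 :: "real^'n"
  assumes G: "continuous_on {0..h} G"
  shows "\<exists>y. y 0 = u0 \<and> (\<forall>s\<in>{0..h}.
      (y has_vector_derivative (G s - A *v y s)) (at s within {0..h}))"
proof -
  define X where "X s = u0 + integral {0..s} (\<lambda>r. mat_exp (r *\<^sub>R A) *v G r)" for s
  define y where "y s = mat_exp (s *\<^sub>R (- A)) *v X s" for s
  have "continuous_on {0..h} (\<lambda>r. mat_exp (r *\<^sub>R A) *v G r)"
    by (intro matvec.continuous_on continuous_intros G)
  then have dX: "(X has_vector_derivative mat_exp (s *\<^sub>R A) *v G s) (at s within {0..h})"
    if "s \<in> {0..h}" for s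
    unfolding X_def
    using that by (auto intro!: derivative_eq_intros integral_has_vector_derivative)
  have "(y has_vector_derivative (G s - A *v y s)) (at s within {0..h})" if "s \<in> {0..h}" for s
  proof -
    have "(y has_vector_derivative
        mat_exp (s *\<^sub>R (- A)) *v (mat_exp (s *\<^sub>R A) *v G s)
          + (- A ** mat_exp (s *\<^sub>R (- A))) *v X s) (at s within {0..h})"
      unfolding y_def
      by (rule matvec.has_vector_derivative[OF mat_exp_has_vector_derivative dX[OF that]])
    moreover have "mat_exp (s *\<^sub>R (- A)) *v (mat_exp (s *\<^sub>R A) *v G s) = G s"
      using mat_exp_inverse[of s "- A"] by (simp add: matrix_vector_mul_assoc)
    moreover have "(- A ** mat_exp (s *\<^sub>R (- A))) *v X s = - (A *v y s)"
      by (simp add: y_def matvec.minus_left matmat.minus_left matrix_vector_mul_assoc)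
    ultimately show ?thesis
      by simp
  qed
  moreover have "y 0 = u0"
    by (simp add: y_def X_def)
  ultimately show ?thesis
    by blast
qed

section \<open>Exponential Fourier collocation as exact integration\<close>

lemma continuous_on_legendre_shifted [continuous_intros]:
  "continuous_on S f \<Longrightarrow> continuous_on S (\<lambda>x. legendre_shifted j (f x))"
  unfolding legendre_shifted_def by (intro continuous_intros)

text \<open>The expansion of the right-hand side in the first \<open>n\<close> shifted Legendre polynomials, with the
  integrals for the Fourier coefficients replaced by the quadrature formula; \<open>F l\<close> stands for
  the value at the node \<open>c l\<close>.\<close>

definition fourier_rhs ::
  "nat \<Rightarrow> nat \<Rightarrow> (nat \<Rightarrow> real) \<Rightarrow> (nat \<Rightarrow> real) \<Rightarrow> (nat \<Rightarrow> real^'n) \<Rightarrow> real \<Rightarrow> real^'n" where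
  "fourier_rhs k n c b F \<xi> =
     (\<Sum>j<n. legendre_shifted j \<xi> *\<^sub>R (\<Sum>l=1..k. (b l * legendre_shifted j (c l)) *\<^sub>R F l))"

lemma continuous_on_fourier_rhs [continuous_intros]:
  "continuous_on S f \<Longrightarrow> continuous_on S (\<lambda>x. fourier_rhs k n c b F (f x))"
  unfolding fourier_rhs_def by (intro continuous_intros)

text \<open>The stage equations and the final update of EFCM are one formula, evaluated at the nodes
  and at 1. Taking the values \<open>F\<close> of the right-hand side as data makes it explicit.\<close>

definition efcm_value ::
  "nat \<Rightarrow> nat \<Rightarrow> (nat \<Rightarrow> real) \<Rightarrow> (nat \<Rightarrow> real) \<Rightarrow> real \<Rightarrow> real^'n^'n \<Rightarrow> real^'n \<Rightarrow>
   (nat \<Rightarrow> real^'n) \<Rightarrow> real \<Rightarrow> real^'n" where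
  "efcm_value k n c b h A u0 F \<gamma> = phi 0 (- (\<gamma> *\<^sub>R h *\<^sub>R A)) *v u0 +
     (\<gamma> * h) *\<^sub>R (\<Sum>l=1..k. b l *\<^sub>R
       ((\<Sum>j<n. legendre_shifted j (c l) *\<^sub>R I_coeff_at j \<gamma> (h *\<^sub>R A)) *v F l))"

lemma efcm_iff_efcm_value:
  "efcm k n c b h A g u0 v w \<longleftrightarrow>
     (\<forall>i\<in>{1..k}. v i = efcm_value k n c b h A u0 (\<lambda>l. g (c l * h) (v l)) (c i)) \<and>
     w = efcm_value k n c b h A u0 (\<lambda>l. g (c l * h) (v l)) 1"
  by (simp add: efcm_def efcm_value_def Let_def I_coeff_def I_coeff_at_def)

lemma I_coeff_at_has_integral:
  fixes A :: "real^'n^'n"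
  shows "((\<lambda>z. legendre_shifted j (z * \<gamma>) *\<^sub>R mat_exp (- (((1 - z) * (\<gamma> * h)) *\<^sub>R A)))
    has_integral I_coeff_at j \<gamma> (h *\<^sub>R A)) {0..1}"
proof -
  have "continuous_on {0..1} (\<lambda>z. legendre_shifted j (z * \<gamma>) *\<^sub>R
      mat_exp ((- ((1 - z) * (\<gamma> * h))) *\<^sub>R A))"
    by (intro continuous_intros)
  then have "(\<lambda>z. legendre_shifted j (z * \<gamma>) *\<^sub>R mat_exp ((- ((1 - z) * (\<gamma> * h))) *\<^sub>R A))
      integrable_on {0..1}"
    by (rule integrable_continuous_real)
  then show ?thesis
    unfolding I_coeff_at_def by (auto simp: has_integral_integral mult_ac)
qed

text \<open>Variation of constants for a forcing term that is a combination of Legendre polynomials in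
  \<open>s / h\<close>: each polynomial contributes, by definition, one integral \<open>I_coeff_at\<close>. The sums over
  the polynomials and over the nodes are then interchanged.\<close>

lemma efcm_value_eq_solution:
  fixes A :: "real^'n^'n"
  assumes h: "h > 0" and \<gamma>: "\<gamma> \<in> {0..1}" and y0: "y 0 = u0"
    and ode: "\<And>s. s \<in> {0..h} \<Longrightarrow>
      (y has_vector_derivative (fourier_rhs k n c b F (s / h) - A *v y s)) (at s within {0..h})"
  shows "y (\<gamma> * h) = efcm_value k n c b h A u0 F \<gamma>"
proof -
  define W where "W j = (\<Sum>l=1..k. (b l * legendre_shifted j (c l)) *\<^sub>R F l)" for j
  define E where "E z = mat_exp (- (((1 - z) * (\<gamma> * h)) *\<^sub>R A))" for z
  have \<gamma>h: "\<gamma> * h \<in> {0..h}"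
    using h \<gamma> by (simp add: mult_left_le_one_le)
  have I1: "((\<lambda>z. (\<gamma> * h) *\<^sub>R (E z *v fourier_rhs k n c b F (z * (\<gamma> * h) / h)))
      has_integral (y (\<gamma> * h) - mat_exp (- ((\<gamma> * h) *\<^sub>R A)) *v u0)) {0..1}"
    unfolding E_def using variation_of_constants[OF ode \<gamma>h] y0 by simp
  have I2: "(\<gamma> * h) *\<^sub>R (E z *v fourier_rhs k n c b F (z * (\<gamma> * h) / h))
      = (\<gamma> * h) *\<^sub>R (\<Sum>j<n. (legendre_shifted j (z * \<gamma>) *\<^sub>R E z) *v W j)" for z
  proof -
    have "fourier_rhs k n c b F (z * (\<gamma> * h) / h)
        = (\<Sum>j<n. legendre_shifted j (z * \<gamma>) *\<^sub>R W j)"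
      using h unfolding fourier_rhs_def W_def by simp
    then show ?thesis
      by (simp only: matvec.sum_right matvec.scaleR_left matvec.scaleR_right)
  qed
  have I3: "((\<lambda>z. (\<gamma> * h) *\<^sub>R (\<Sum>j<n. (legendre_shifted j (z * \<gamma>) *\<^sub>R E z) *v W j))
      has_integral (\<gamma> * h) *\<^sub>R (\<Sum>j<n. I_coeff_at j \<gamma> (h *\<^sub>R A) *v W j)) {0..1}"
    unfolding E_def
    by (intro has_integral_cmul has_integral_sum finite_lessThan
        has_integral_linear[OF I_coeff_at_has_integral matvec.bounded_linear_left, unfolded o_def])
  have eq: "y (\<gamma> * h) - mat_exp (- ((\<gamma> * h) *\<^sub>R A)) *v u0
      = (\<gamma> * h) *\<^sub>R (\<Sum>j<n. I_coeff_at j \<gamma> (h *\<^sub>R A) *v W j)"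
    by (rule has_integral_unique[OF I1[unfolded I2] I3])
  have "(\<Sum>j<n. I_coeff_at j \<gamma> (h *\<^sub>R A) *v W j) = (\<Sum>l=1..k. b l *\<^sub>R
       ((\<Sum>j<n. legendre_shifted j (c l) *\<^sub>R I_coeff_at j \<gamma> (h *\<^sub>R A)) *v F l))"
    unfolding W_def matvec.sum_right matvec.sum_left scaleR_sum_right
    by (subst sum.swap) (simp add: matvec.scaleR_left matvec.scaleR_right)
  with eq show ?thesis
    by (simp add: efcm_value_def diff_eq_eq add.commute)
qed

text \<open>The forcing term depends on \<open>v\<close> but not on \<open>y\<close>, so a solution \<open>y\<close> exists for any \<open>v\<close>;
  its values at the nodes are the right-hand sides of the stage equations. Hence \<open>v\<close> solves
  these equations if and only if it consists of the values of \<open>y\<close> at the nodes.\<close>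

lemma efcm_iff_fourier_ode:
  fixes A :: "real^'n^'n"
  assumes h: "h > 0" and c: "\<forall>i\<in>{1..k}. c i \<in> {0..1}"
  shows "efcm k n c b h A g u0 v w \<longleftrightarrow>
    (\<exists>y. y 0 = u0 \<and>
      (\<forall>s\<in>{0..h}. (y has_vector_derivative
        (fourier_rhs k n c b (\<lambda>l. g (c l * h) (v l)) (s / h) - A *v y s)) (at s within {0..h})) \<and>
      (\<forall>i\<in>{1..k}. v i = y (c i * h)) \<and> w = y h)"
    (is "_ \<longleftrightarrow> (\<exists>y. ?sol y \<and> ?ode y \<and> ?val y)")
proof -
  have val: "?val y \<longleftrightarrow> efcm k n c b h A g u0 v w" if "?sol y" "?ode y" for y
  proof -
    have "y (\<gamma> * h) = efcm_value k n c b h A u0 (\<lambda>l. g (c l * h) (v l)) \<gamma>"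
      if "\<gamma> \<in> {0..1}" for \<gamma>
      using \<open>?sol y\<close> \<open>?ode y\<close> by (intro efcm_value_eq_solution[OF h that]) auto
    from this[of 1] this[OF bspec[OF c]] show ?thesis
      by (auto simp: efcm_iff_efcm_value)
  qed
  have "continuous_on {0..h} (\<lambda>s. fourier_rhs k n c b (\<lambda>l. g (c l * h) (v l)) (s / h))"
    using h by (intro continuous_intros) auto
  then obtain y where "?sol y" "?ode y"
    using linear_ode_solution_exists by blast
  with val show ?thesis
    by blast
qed

section \<open>The second-order problem as a stacked system\<close>

definition lower :: "real^('d + 'd) \<Rightarrow> real^'d" where
  "lower u = (\<chi> a. u $ Inr a)"

lemma upper_stack [simp]: "upper (stack x y) = x"
  and lower_stack [simp]: "lower (stack x y) = y"
  and stack_upper_lower [simp]: "stack (upper u) (lower u) = u"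
  by (simp_all add: stack_def upper_def lower_def vec_eq_iff split: sum.split)

lemma stack_eq_iff: "stack x y = u \<longleftrightarrow> x = upper u \<and> y = lower u"
  by auto

lemma upper_linear: "linear upper" and lower_linear: "linear lower"
  by (simp_all add: linear_iff upper_def lower_def vec_eq_iff)

lemma upper_system_matrix: "upper (system_matrix M *v u) = - lower u"
  and lower_system_matrix: "lower (system_matrix M *v u) = M *v upper u"
  by (simp_all add: vec_eq_iff upper_def lower_def matrix_vector_mult_def system_matrix_def
      block_matrix_def mat_def UNIV_Plus_UNIV[symmetric] sum.Plus if_distrib[of "\<lambda>x. x * _"]
      if_distrib[of uminus] cong: if_cong del: UNIV_Plus_UNIV)

lemma upper_fourier_rhs_system:
    "upper (fourier_rhs k n c b (\<lambda>l. system_rhs f (t l) (u l)) \<xi>) = 0"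
  and lower_fourier_rhs_system:
    "lower (fourier_rhs k n c b (\<lambda>l. system_rhs f (t l) (u l)) \<xi>)
      = fourier_rhs k n c b (\<lambda>l. f (upper (u l))) \<xi>"
  by (simp_all add: fourier_rhs_def system_rhs_def linear_sum[OF upper_linear]
      linear_sum[OF lower_linear] linear_cmul[OF upper_linear] linear_cmul[OF lower_linear])

lemma has_vector_derivative_stack_iff:
  "(y has_vector_derivative y') (at s within S) \<longleftrightarrow>
    ((\<lambda>t. upper (y t)) has_vector_derivative upper y') (at s within S) \<and>
    ((\<lambda>t. lower (y t)) has_vector_derivative lower y') (at s within S)"
  (is "_ \<longleftrightarrow> ?U \<and> ?L")
proof
  assume "(y has_vector_derivative y') (at s within S)"
  then show "?U \<and> ?L"
    using bounded_linear.has_vector_derivative[OF upper_linear[unfolded linear_conv_bounded_linear]]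
      bounded_linear.has_vector_derivative[OF lower_linear[unfolded linear_conv_bounded_linear]]
    by blast
next
  have decomp: "stack (upper u) 0 + stack 0 (lower u) = u" for u :: "real^('d::finite + 'd)"
    by (simp add: stack_def upper_def lower_def vec_eq_iff split: sum.split)
  have upper_part: "bounded_linear (\<lambda>x. stack x 0)"
    and lower_part: "bounded_linear (\<lambda>x. stack 0 x)"
    unfolding linear_conv_bounded_linear[symmetric] linear_iff
    by (auto simp: stack_def vec_eq_iff split: sum.split)
  assume parts: "?U \<and> ?L"
  have "((\<lambda>t. stack (upper (y t)) 0 + stack 0 (lower (y t)))
      has_vector_derivative stack (upper y') 0 + stack 0 (lower y')) (at s within S)"
    by (rule has_vector_derivative_add
        [OF bounded_linear.has_vector_derivative[OF upper_part parts[THEN conjunct1]]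
          bounded_linear.has_vector_derivative[OF lower_part parts[THEN conjunct2]]])
  then show "(y has_vector_derivative y') (at s within S)"
    by (simp only: decomp)
qed

text \<open>The stages \<open>V\<close> enter the right-hand side only through their upper halves, so only
  these need to agree with the values of \<open>y\<close> at the nodes.\<close>

lemma tfcm_solution_iff_system:
  fixes M :: "real^'d^'d"
  assumes h: "h > 0" and stages: "\<And>l. l \<in> {1..k} \<Longrightarrow> upper (V l) = upper (y (c l * h))"
  shows "tfcm_solution k n c b h M f q0 q0' (\<lambda>t. upper (y t)) (\<lambda>t. lower (y t)) \<longleftrightarrow>
    y 0 = stack q0 q0' \<and>
    (\<forall>s\<in>{0..h}. (y has_vector_derivative
      (fourier_rhs k n c b (\<lambda>l. system_rhs f (c l * h) (V l)) (s / h) - system_matrix M *v y s))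
      (at s within {0..h}))"
proof -
  have image: "{0..h} = (\<lambda>\<xi>. \<xi> * h) ` {0..1}"
    using image_mult_atLeastAtMost[OF h, of 0 1] by (subst mult.commute) simp
  have rhs: "fourier_rhs k n c b (\<lambda>l. f (upper (V l))) \<xi> =
      (\<Sum>j<n. legendre_shifted j \<xi> *\<^sub>R
        (\<Sum>l=1..k. (b l * legendre_shifted j (c l)) *\<^sub>R f (upper (y (c l * h)))))" for \<xi>
    by (simp add: fourier_rhs_def stages)
  have "(\<forall>s\<in>{0..h}. P s) \<longleftrightarrow> (\<forall>\<xi>\<in>{0..1}. P (\<xi> * h))" for P
    unfolding image by blast
  then show ?thesis
    using h
    by (auto simp: tfcm_solution_def has_vector_derivative_stack_iff[of y]
        linear_diff[OF upper_linear] linear_diff[OF lower_linear]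
        upper_system_matrix lower_system_matrix upper_fourier_rhs_system
        lower_fourier_rhs_system rhs)
qed

theorem theorem3p4:
  fixes k n m :: nat
    and c b :: "nat \<Rightarrow> real"
    and h :: real
    and M :: "real^'d^'d"
    and f :: "real^'d \<Rightarrow> real^'d"
    and q0 q0' :: "real^'d"
    and Q :: "nat \<Rightarrow> real^'d"
    and q1 p1 :: "real^'d"
  assumes "2 \<le> n" and "n \<le> k" and "k \<le> m"
    and "0 \<le> c 1" and "mono_on {1..k} c" and "c k \<le> 1"
    and "quadrature_exact k b c (m - 1)"
    and "h > 0"
  shows "(\<exists>P :: nat \<Rightarrow> real^'d.
            efcm k n c b h (system_matrix M) (system_rhs f) (stack q0 q0')
              (\<lambda>l. stack (Q l) (P l)) (stack q1 p1))
         \<longleftrightarrow> tfcm k n c b h M f q0 q0' Q q1 p1"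
proof
  have c: "\<forall>i\<in>{1..k}. c i \<in> {0..1}"
  proof
    fix i assume "i \<in> {1..k}"
    then show "c i \<in> {0..1}"
      using monotone_onD[OF \<open>mono_on {1..k} c\<close>, of 1 i] \<open>0 \<le> c 1\<close> \<open>c k \<le> 1\<close>
        monotone_onD[OF \<open>mono_on {1..k} c\<close>, of i k] by auto
  qed
  note efcm_ode = efcm_iff_fourier_ode[OF \<open>h > 0\<close> c]
  {
    assume "\<exists>P. efcm k n c b h (system_matrix M) (system_rhs f) (stack q0 q0')
              (\<lambda>l. stack (Q l) (P l)) (stack q1 p1)"
    then obtain P y where y: "y 0 = stack q0 q0'"
      "\<forall>s\<in>{0..h}. (y has_vector_derivative
        (fourier_rhs k n c b (\<lambda>l. system_rhs f (c l * h) (stack (Q l) (P l))) (s / h)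
          - system_matrix M *v y s)) (at s within {0..h})"
      "\<forall>i\<in>{1..k}. stack (Q i) (P i) = y (c i * h)" "stack q1 p1 = y h"
      unfolding efcm_ode by blast
    then have "tfcm_solution k n c b h M f q0 q0' (\<lambda>t. upper (y t)) (\<lambda>t. lower (y t))"
      by (subst tfcm_solution_iff_system[OF \<open>h > 0\<close>]) auto
    moreover have "\<forall>l\<in>{1..k}. Q l = upper (y (c l * h))" "q1 = upper (y h)" "p1 = lower (y h)"
      using y by (auto simp: stack_eq_iff)
    ultimately show "tfcm k n c b h M f q0 q0' Q q1 p1"
      unfolding tfcm_def by blast
  next
    assume "tfcm k n c b h M f q0 q0' Q q1 p1"
    then obtain vT uT where sol: "tfcm_solution k n c b h M f q0 q0' vT uT"
      and vals: "\<forall>l\<in>{1..k}. Q l = vT (c l * h)" "q1 = vT h" "p1 = uT h"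
      unfolding tfcm_def by blast
    define y where "y t = stack (vT t) (uT t)" for t
    \<comment> \<open>The velocities at the nodes supply the second half of the EFCM stages.\<close>
    define P where "P l = uT (c l * h)" for l
    have "y 0 = stack q0 q0' \<and> (\<forall>s\<in>{0..h}. (y has_vector_derivative
        (fourier_rhs k n c b (\<lambda>l. system_rhs f (c l * h) (stack (Q l) (P l))) (s / h)
          - system_matrix M *v y s)) (at s within {0..h}))"
      using sol vals
      by (subst tfcm_solution_iff_system[OF \<open>h > 0\<close>, symmetric]) (auto simp: y_def)
    moreover have "\<forall>i\<in>{1..k}. stack (Q i) (P i) = y (c i * h)" "stack q1 p1 = y h"
      using vals by (auto simp: y_def P_def)
    ultimately show "\<exists>P. efcm k n c b h (system_matrix M) (system_rhs f) (stack q0 q0')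
              (\<lambda>l. stack (Q l) (P l)) (stack q1 p1)"
      unfolding efcm_ode by blast
  }
qed

end
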